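(* Let $G$ be a finite subgroup of $PSL(2,\mathbb{C})$, and let $\eta$ be a rational 1-form on the Riemann sphere $\widehat{\mathbb{C}}$ all of whose poles and zeros are simple. Let $\mathcal{P}_\eta$ and $\mathcal{Z}_\eta$ be its sets of poles and zeros. Then $\eta$ is $G$-invariant if and only if the following three conditions hold: 1) $\mathcal{P}_\eta$ is $G$-invariant. 2) $\mathcal{Z}_\eta$ is $G$-invariant. 3) For each non-trivial $g\in G$, with set of fixed points $\{x,y\}\subset\widehat{\mathbb{C}}$, one of the following is satisfied: (a) $g^2$ is the identity and $\{x,y\}\subset\mathcal{P}_\eta\cup\mathcal{Z}_\eta$; (b) $g$ is of order greater than $2$ and $\{x,y\}\subset\mathcal{P}_\eta$. Moreover, $G$ is the maximal group, as a subgroup of $PSL(2,\mathbb{C})$, satisfying 1)–3) if and only if $\eta$ has isotropy group $G$.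
   Context: $PSL(2,\mathbb{C})$ acts on $\widehat{\mathbb{C}}$ by Möbius transformations; $T_*\eta=(T^{-1})^*\eta$ denotes push-forward. $\eta$ is $G$-invariant if $g_*\eta=\eta$ for all $g\in G$. The isotropy group of $\eta$ is $\{T\in PSL(2,\mathbb{C}): T_*\eta=\eta\}$. A set $S\subset\widehat{\mathbb{C}}$ is $G$-invariant if $g(S)=S$ for all $g\in G$. Poles and zeros at $\infty$ are included in $\mathcal{P}_\eta$ and $\mathcal{Z}_\eta$. *)

theory Defs
  imports
    "HOL-Analysis.Analysis"
    "HOL-Computational_Algebra.Computational_Algebra"
    "HOL-Computational_Algebra.Field_as_Ring"
    "HOL-Algebra.Coset"
    "HOL-Algebra.Multiplicative_Group"
begin

text \<open>Here \<open>$\<close> is always \<^const>\<open>vec_nth\<close>.\<close>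

no_notation fps_nth (infixl \<open>$\<close> 75)

text \<open>The Riemann sphere, with \<open>None\<close> as the point at infinity (the points of the library's
  one-point compactification \<^const>\<open>Alexandroff_compactification\<close> of the complex plane).\<close>

type_synonym riemann_sphere = "complex option"

definition SL2C :: "(complex^2^2) monoid" where
  "SL2C = \<lparr>carrier = {A. det A = 1}, mult = (**), one = mat 1\<rparr>"

definition PSL2C :: "(complex^2^2) set monoid" where
  "PSL2C = SL2C Mod {mat 1, - mat 1}"

definition mat_act :: "complex^2^2 \<Rightarrow> riemann_sphere \<Rightarrow> riemann_sphere" where
  "mat_act A x = (case x of
      None \<Rightarrow> if A$2$1 = 0 then None else Some (A$1$1 / A$2$1)
    | Some z \<Rightarrow> if A$2$1 * z + A$2$2 = 0 then None
               else Some ((A$1$1 * z + A$1$2) / (A$2$1 * z + A$2$2)))"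

text \<open>An element of \<^const>\<open>PSL2C\<close> is a set \<open>{A, - A}\<close>, and both representatives act in the same
  way (\<open>PSL_act_eq\<close> below), so \<^const>\<open>the_elem\<close> picks the value.\<close>

definition PSL_act :: "(complex^2^2) set \<Rightarrow> riemann_sphere \<Rightarrow> riemann_sphere" where
  "PSL_act T x = the_elem ((\<lambda>A. mat_act A x) ` T)"

definition fixed_points :: "(complex^2^2) set \<Rightarrow> riemann_sphere set" where
  "fixed_points T = {x. PSL_act T x = x}"

definition set_invariant :: "(complex^2^2) set set \<Rightarrow> riemann_sphere set \<Rightarrow> bool" where
  "set_invariant G S \<longleftrightarrow> (\<forall>g\<in>G. PSL_act g ` S = S)"

text \<open>Rational functions, as elements of the field \<open>\<complex>(z)\<close>. \<^const>\<open>quot_of_fract\<close> gives numerator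
  and denominator in lowest terms.\<close>

type_synonym ratfun = "complex poly fract"

text \<open>\<open>ratfun_comp f t\<close> is \<open>f \<circ> t\<close>; it is only meaningful for non-constant \<open>t\<close>.\<close>

definition ratfun_comp :: "ratfun \<Rightarrow> ratfun \<Rightarrow> ratfun" where
  "ratfun_comp f t = (case quot_of_fract f of (p, q) \<Rightarrow>
     poly (map_poly (\<lambda>c. to_fract [:c:]) p) t / poly (map_poly (\<lambda>c. to_fract [:c:]) q) t)"

definition ratfun_deriv :: "ratfun \<Rightarrow> ratfun" where
  "ratfun_deriv f = (case quot_of_fract f of (p, q) \<Rightarrow>
     Fract (pderiv p * q - p * pderiv q) (q ^ 2))"

definition mat_ratfun :: "complex^2^2 \<Rightarrow> ratfun" where
  "mat_ratfun A = Fract [:A$1$2, A$1$1:] [:A$2$2, A$2$1:]"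

definition PSL_ratfun :: "(complex^2^2) set \<Rightarrow> ratfun" where
  "PSL_ratfun T = the_elem (mat_ratfun ` T)"

text \<open>A rational 1-form on the sphere is \<open>f(z) dz\<close> for a unique rational function \<open>f\<close>, which
  represents it here. The pullback of \<open>f(z) dz\<close> along \<open>t\<close> is \<open>f(t(z)) t'(z) dz\<close>.\<close>

type_synonym ratform = ratfun

definition pullback :: "ratfun \<Rightarrow> ratform \<Rightarrow> ratform" where
  "pullback t \<eta> = ratfun_comp \<eta> t * ratfun_deriv t"

definition pushforward :: "(complex^2^2) set \<Rightarrow> ratform \<Rightarrow> ratform" where
  "pushforward T \<eta> = pullback (PSL_ratfun (inv\<^bsub>PSL2C\<^esub> T)) \<eta>"

definition form_invariant :: "(complex^2^2) set set \<Rightarrow> ratform \<Rightarrow> bool" where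
  "form_invariant G \<eta> \<longleftrightarrow> (\<forall>g\<in>G. pushforward g \<eta> = \<eta>)"

definition isotropy_group :: "ratform \<Rightarrow> (complex^2^2) set set" where
  "isotropy_group \<eta> = {T \<in> carrier PSL2C. pushforward T \<eta> = \<eta>}"

definition ratfun_order :: "complex \<Rightarrow> ratfun \<Rightarrow> int" where
  "ratfun_order a f = (case quot_of_fract f of (p, q) \<Rightarrow>
     int (Polynomial.order a p) - int (Polynomial.order a q))"

text \<open>At infinity the order is read off in the chart \<open>w = 1/z\<close>, where the form is its pullback
  along \<open>w \<mapsto> 1/w\<close>. The value for the zero form is meaningless.\<close>

definition form_order :: "ratform \<Rightarrow> riemann_sphere \<Rightarrow> int" where
  "form_order \<eta> x = (case x of
      Some a \<Rightarrow> ratfun_order a \<eta>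
    | None \<Rightarrow> ratfun_order 0 (pullback (Fract 1 [:0, 1:]) \<eta>))"

definition form_poles :: "ratform \<Rightarrow> riemann_sphere set" where
  "form_poles \<eta> = {x. form_order \<eta> x < 0}"

definition form_zeros :: "ratform \<Rightarrow> riemann_sphere set" where
  "form_zeros \<eta> = {x. form_order \<eta> x > 0}"

definition simple_poles_and_zeros :: "ratform \<Rightarrow> bool" where
  "simple_poles_and_zeros \<eta> \<longleftrightarrow>
     (\<forall>x\<in>form_poles \<eta>. form_order \<eta> x = -1) \<and> (\<forall>x\<in>form_zeros \<eta>. form_order \<eta> x = 1)"

text \<open>\<^const>\<open>group.ord\<close> is \<open>0\<close> on elements of infinite order; these count as having order
  greater than 2.\<close>

definition fixed_point_condition :: "(complex^2^2) set set \<Rightarrow> ratform \<Rightarrow> bool" where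
  "fixed_point_condition G \<eta> \<longleftrightarrow>
     (\<forall>g\<in>G. g \<noteq> \<one>\<^bsub>PSL2C\<^esub> \<longrightarrow>
        (g [^]\<^bsub>PSL2C\<^esub> (2::nat) = \<one>\<^bsub>PSL2C\<^esub> \<and>
           fixed_points g \<subseteq> form_poles \<eta> \<union> form_zeros \<eta>) \<or>
        ((group.ord PSL2C g = 0 \<or> group.ord PSL2C g > 2) \<and>
           fixed_points g \<subseteq> form_poles \<eta>))"

definition invariance_conditions :: "(complex^2^2) set set \<Rightarrow> ratform \<Rightarrow> bool" where
  "invariance_conditions G \<eta> \<longleftrightarrow>
     set_invariant G (form_poles \<eta>) \<and> set_invariant G (form_zeros \<eta>) \<and>
     fixed_point_condition G \<eta>"

lemma group_SL2C: "group SL2C"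
proof (rule groupI)
  fix A assume A: "A \<in> carrier SL2C"
  hence "invertible A" by (simp add: SL2C_def invertible_det_nz)
  then obtain B where I: "B ** A = mat 1" by (auto simp: invertible_def)
  hence "det B * det A = 1" by (metis det_I det_mul)
  thus "\<exists>B\<in>carrier SL2C. B \<otimes>\<^bsub>SL2C\<^esub> A = \<one>\<^bsub>SL2C\<^esub>"
    using A I by (auto simp: SL2C_def intro!: bexI[of _ B])
qed (auto simp: SL2C_def det_mul matrix_mul_assoc)

lemma det_uminus_2: "det (- A) = det (A :: complex^2^2)"
  by (simp add: det_2)

lemma matrix_mult_uminus: "(- A) ** B = - (A ** B)" "A ** (- B) = - (A ** B)"
  for A B :: "complex^2^2"
  by (simp_all add: vec_eq_iff matrix_matrix_mult_def sum_negf)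

lemma SL2C_inv_uminus_one: "inv\<^bsub>SL2C\<^esub> (- mat 1) = - mat 1"
  by (rule group.inv_equality[OF group_SL2C])
     (auto simp: SL2C_def matrix_mult_uminus det_uminus_2)

lemma subgroup_SL2C_centre: "subgroup {mat 1, - mat 1} SL2C"
proof (rule group.subgroupI[OF group_SL2C])
  show "inv\<^bsub>SL2C\<^esub> A \<in> {mat 1, - mat 1}" if "A \<in> {mat 1, - mat 1}" for A
    using that SL2C_inv_uminus_one monoid.inv_one[OF group.is_monoid[OF group_SL2C]]
    by (auto simp: SL2C_def)
qed (auto simp: SL2C_def matrix_mult_uminus det_uminus_2)

lemma SL2C_coset: "{mat 1, - mat 1} #>\<^bsub>SL2C\<^esub> A = {A, - A}"
  by (auto simp: r_coset_def SL2C_def matrix_mult_uminus)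

lemma SL2C_lcoset: "A <#\<^bsub>SL2C\<^esub> {mat 1, - mat 1} = {A, - A}"
  by (auto simp: l_coset_def SL2C_def matrix_mult_uminus)

lemma normal_SL2C_centre: "{mat 1, - mat 1} \<lhd> SL2C"
  using group_SL2C subgroup_SL2C_centre
  by (simp add: normal_def normal_axioms_def SL2C_coset SL2C_lcoset)

lemma group_PSL2C: "group PSL2C"
  unfolding PSL2C_def by (rule normal.factorgroup_is_group[OF normal_SL2C_centre])

lemma carrier_PSL2C: "carrier PSL2C = {{A, - A} | A. det A = 1}"
  by (auto simp: PSL2C_def FactGroup_def RCOSETS_def SL2C_coset) (auto simp: SL2C_def)

lemma mat_act_uminus: "mat_act (- A) x = mat_act A x"
proof (cases x)
  case (Some z)
  have eq: "(- A)$2$1 * z + (- A)$2$2 = - (A$2$1 * z + A$2$2)"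
           "(- A)$1$1 * z + (- A)$1$2 = - (A$1$1 * z + A$1$2)" by simp_all
  show ?thesis
    unfolding mat_act_def Some option.case eq
    by (simp only: neg_equal_0_iff_equal minus_divide_divide)
qed (simp add: mat_act_def)

lemma mat_ratfun_uminus: "det A = 1 \<Longrightarrow> mat_ratfun (- A) = mat_ratfun A"
proof -
  assume "det A = 1"
  hence nz: "[:A$2$2, A$2$1:] \<noteq> 0" "[:- A$2$2, - A$2$1:] \<noteq> 0" by (auto simp: det_2)
  show ?thesis
    by (simp add: mat_ratfun_def eq_fract(1)[OF nz(2,1)])
qed

lemma PSL_act_eq: "PSL_act {A, - A} x = mat_act A x"
  by (simp add: PSL_act_def mat_act_uminus)

lemma PSL_ratfun_eq: "det A = 1 \<Longrightarrow> PSL_ratfun {A, - A} = mat_ratfun A"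
  by (simp add: PSL_ratfun_def mat_ratfun_uminus)

end

theory Submission
  imports Defs
begin

text \<open>
Invariance of a form under a group is a condition on each element \<open>g \<noteq> 1\<close> separately, and so are the
three conditions of the theorem. Everything is thus a statement about a single Moebius transformation
\<open>g\<close>, and the whole argument rests on the multiplier at a fixed point. In a local coordinate \<open>w\<close> with
\<open>w = 0\<close> at the fixed point, \<open>g\<close> is \<open>w \<mapsto> l w + \<dots>\<close> and the form is \<open>(L w ^ k + \<dots>) dw\<close> with
\<open>L \<noteq> 0\<close>, where \<open>k\<close> is the order of the form there. If \<open>g\<close> multiplies the form by a constant \<open>c\<close>, then
comparing leading coefficients yields \<open>c = l ^ (k + 1)\<close> (\<open>fixed_point_multiplier\<close>).

If the form is invariant then \<open>c = 1\<close>, and \<open>g\<close> preserves zeros and poles because the order is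
invariant under changes of coordinate (\<open>form_order_pull\<close>). The number \<open>k\<close> is \<open>-1\<close>, \<open>0\<close> or \<open>1\<close>, as
all zeros and poles are simple. If \<open>l \<noteq> 1\<close> then \<open>l ^ (k + 1) = 1\<close> leaves only \<open>k = -1\<close>, a pole, or
\<open>k = 1\<close> and \<open>l = -1\<close>, a zero and an involution. The case \<open>l = 1\<close> is that of a parabolic \<open>g\<close>, which is a
translation after moving its fixed point to infinity. Then the form is \<open>h(z) dz\<close> with a periodic
rational function \<open>h\<close>, hence with a constant one (\<open>periodic_ratfun_const\<close>), so that it has a double pole
at the fixed point, which is excluded.

Conversely, a \<open>g\<close> that preserves the zeros and the poles preserves all orders, again by simplicity, and
so multiplies the form by a constant \<open>c\<close> (\<open>ratfun_proportional_if_orders_eq\<close>). By the fundamental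
theorem of algebra \<open>g\<close> has a fixed point, and the third condition yields \<open>c = l ^ (k + 1) = 1\<close>
there.

The elements that fix the form make up a subgroup (\<open>subgroup_isotropy_group\<close>), and a subgroup satisfies
the conditions exactly if it is contained in it. This is the statement on maximality.
\<close>

section \<open>Values of rational functions\<close>

text \<open>Since the fraction is in lowest terms, the denominator vanishes exactly at the finite poles; there
the value is \<open>0\<close>.\<close>

definition ratfun_val :: "ratfun \<Rightarrow> complex \<Rightarrow> complex" where
  "ratfun_val f z = poly (fst (quot_of_fract f)) z / poly (snd (quot_of_fract f)) z"

lemma eventually_cofinite_poly_nonzero:
  fixes p :: "complex poly"
  assumes "p \<noteq> 0"
  shows "eventually (\<lambda>z. poly p z \<noteq> 0) cofinite"
  using poly_roots_finite[OF assms] by (simp add: eventually_cofinite)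

lemma quot_of_fract_Fract_cross:
  fixes p q :: "complex poly"
  assumes "q \<noteq> 0"
  shows "fst (quot_of_fract (Fract p q)) * q = p * snd (quot_of_fract (Fract p q))"
proof -
  have "Fract (fst (quot_of_fract (Fract p q))) (snd (quot_of_fract (Fract p q))) = Fract p q"
    by simp
  thus ?thesis using assms by (simp add: eq_fract del: Fract_quot_of_fract)
qed

lemma ratfun_val_Fract:
  assumes "q \<noteq> 0"
  shows "eventually (\<lambda>z. ratfun_val (Fract p q) z = poly p z / poly q z) cofinite"
proof -
  let ?f = "Fract p q"
  have *: "poly (fst (quot_of_fract ?f)) z * poly q z = poly p z * poly (snd (quot_of_fract ?f)) z" for z
    using quot_of_fract_Fract_cross[OF assms, of p] by (metis poly_mult)
  have "eventually (\<lambda>z. poly q z \<noteq> 0) cofinite"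
    "eventually (\<lambda>z. poly (snd (quot_of_fract ?f)) z \<noteq> 0) cofinite"
    using assms by (auto intro!: eventually_cofinite_poly_nonzero)
  thus ?thesis
  proof eventually_elim
    case (elim z)
    thus ?case using *[of z] by (simp add: ratfun_val_def frac_eq_eq)
  qed
qed

text \<open>A nonzero polynomial vanishes at finitely many points only, so a rational function is determined by
its values at infinitely many points. Identities between elements of \<open>\<complex>(z)\<close> can therefore be
checked on values, and finitely many bad points may be discarded on the way; this is why the
identities below hold eventually along the filter \<^const>\<open>cofinite\<close>.\<close>

lemma ratfun_eqI:
  assumes "frequently (\<lambda>z. ratfun_val f z = ratfun_val g z) cofinite"
  shows "f = g"
proof -
  obtain a b where f: "f = Fract a b" "b \<noteq> 0" by (cases f) auto
  obtain c d where g: "g = Fract c d" "d \<noteq> 0" by (cases g) auto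
  have "frequently (\<lambda>z. poly (a * d - c * b) z = 0) cofinite"
    using assms
  proof (rule frequently_rev_mp)
    show "eventually (\<lambda>z. ratfun_val f z = ratfun_val g z \<longrightarrow> poly (a * d - c * b) z = 0) cofinite"
      using ratfun_val_Fract[OF f(2), of a] ratfun_val_Fract[OF g(2), of c]
        eventually_cofinite_poly_nonzero[OF f(2)] eventually_cofinite_poly_nonzero[OF g(2)]
      by eventually_elim (auto simp: f(1) g(1) frac_eq_eq)
  qed
  hence "a * d - c * b = 0"
    using poly_roots_finite[of "a * d - c * b"] by (auto simp: frequently_cofinite)
  thus ?thesis using f g by (simp add: eq_fract)
qed

lemma ratfun_val_add:
  "eventually (\<lambda>z. ratfun_val (f + g) z = ratfun_val f z + ratfun_val g z) cofinite"
proof -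
  obtain a b where f: "f = Fract a b" "b \<noteq> 0" by (cases f) auto
  obtain c d where g: "g = Fract c d" "d \<noteq> 0" by (cases g) auto
  have "b * d \<noteq> 0" using f g by simp
  from ratfun_val_Fract[OF f(2), of a] ratfun_val_Fract[OF g(2), of c]
    eventually_cofinite_poly_nonzero[OF f(2)] eventually_cofinite_poly_nonzero[OF g(2)]
    ratfun_val_Fract[OF this, of "a * d + c * b"]
  show ?thesis
    by eventually_elim (use f g in \<open>simp add: add_frac_eq\<close>)
qed

lemma ratfun_val_mult:
  "eventually (\<lambda>z. ratfun_val (f * g) z = ratfun_val f z * ratfun_val g z) cofinite"
proof -
  obtain a b where f: "f = Fract a b" "b \<noteq> 0" by (cases f) auto
  obtain c d where g: "g = Fract c d" "d \<noteq> 0" by (cases g) auto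
  have "b * d \<noteq> 0" using f g by simp
  from ratfun_val_Fract[OF f(2), of a] ratfun_val_Fract[OF g(2), of c]
    ratfun_val_Fract[OF this, of "a * c"]
  show ?thesis
    by eventually_elim (use f g in simp)
qed

lemma ratfun_val_divide:
  "eventually (\<lambda>z. ratfun_val (f / g) z = ratfun_val f z / ratfun_val g z) cofinite"
proof (cases "g = 0")
  case True
  thus ?thesis by (simp add: ratfun_val_def)
next
  case False
  obtain a b where f: "f = Fract a b" "b \<noteq> 0" by (cases f) auto
  obtain c d where g: "g = Fract c d" "d \<noteq> 0" by (cases g) auto
  have "c \<noteq> 0" using False g by (auto simp: rat_number_collapse fract_collapse)
  hence "b * c \<noteq> 0" using f g by simp
  from ratfun_val_Fract[OF f(2), of a] ratfun_val_Fract[OF g(2), of c]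
    ratfun_val_Fract[OF this, of "a * d"]
  show ?thesis
    by eventually_elim (use f g in simp)
qed

lemma ratfun_val_const:
  "eventually (\<lambda>z. ratfun_val (to_fract [:c:]) z = c) cofinite"
  using ratfun_val_Fract[of 1 "[:c:]"] by (simp add: to_fract_def)

lemma ratfun_val_poly:
  "eventually (\<lambda>z. ratfun_val (poly (map_poly (\<lambda>c. to_fract [:c:]) p) t) z = poly p (ratfun_val t z))
     cofinite"
proof (induction p)
  case 0
  show ?case by (simp add: ratfun_val_def)
next
  case (pCons a p)
  let ?P = "poly (map_poly (\<lambda>c. to_fract [:c:]) p) t"
  have eq: "poly (map_poly (\<lambda>c. to_fract [:c:]) (pCons a p)) t = to_fract [:a:] + t * ?P"
    using pCons.hyps by (simp add: map_poly_pCons)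
  from pCons.IH ratfun_val_const[of a] ratfun_val_mult[of t ?P]
    ratfun_val_add[of "to_fract [:a:]" "t * ?P"]
  show ?case unfolding eq by eventually_elim simp
qed

lemma ratfun_val_comp:
  "eventually (\<lambda>z. ratfun_val (ratfun_comp f t) z = ratfun_val f (ratfun_val t z)) cofinite"
proof -
  let ?P = "\<lambda>p. poly (map_poly (\<lambda>c. to_fract [:c:]) p) t"
  let ?p = "fst (quot_of_fract f)" and ?q = "snd (quot_of_fract f)"
  have eq: "ratfun_comp f t = ?P ?p / ?P ?q"
    by (simp add: ratfun_comp_def case_prod_beta)
  from ratfun_val_poly[of ?p t] ratfun_val_poly[of ?q t] ratfun_val_divide[of "?P ?p" "?P ?q"]
  show ?thesis unfolding eq
    by eventually_elim (simp add: ratfun_val_def[of f])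
qed

text \<open>The derivative is defined through the fraction in lowest terms; the quotient rule holds for any
other representation because \<open>p v = u q\<close> can be differentiated.\<close>

lemma ratfun_deriv_Fract:
  assumes "v \<noteq> 0"
  shows "ratfun_deriv (Fract u v) = Fract (pderiv u * v - u * pderiv v) (v ^ 2)"
proof -
  define p q where "p = fst (quot_of_fract (Fract u v))" and "q = snd (quot_of_fract (Fract u v))"
  have q: "q \<noteq> 0" by (simp add: q_def)
  have c: "p * v = u * q"
    using quot_of_fract_Fract_cross[OF assms, of u] by (simp add: p_def q_def)
  have d: "pderiv p * v + p * pderiv v = pderiv u * q + u * pderiv q"
    using arg_cong[OF c, of pderiv] by (simp add: pderiv_mult algebra_simps)
  have "(pderiv p * q - p * pderiv q) * v ^ 2 = (pderiv u * v - u * pderiv v) * q ^ 2"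
  proof -
    have "(pderiv p * q - p * pderiv q) * v ^ 2 =
        (pderiv p * v + p * pderiv v) * (q * v) - (p * v) * (q * pderiv v + v * pderiv q)"
      by (simp add: algebra_simps power2_eq_square)
    also have "\<dots> = (pderiv u * v - u * pderiv v) * q ^ 2"
      unfolding c d by (simp add: algebra_simps power2_eq_square)
    finally show ?thesis .
  qed
  thus ?thesis using q assms
    by (simp add: ratfun_deriv_def case_prod_beta eq_fract flip: p_def q_def)
qed

section \<open>Pull-back along Moebius transformations\<close>

lemma matrix_mult_2:
  fixes A B :: "complex^2^2"
  shows "(A ** B) $ i $ j = A$i$1 * B$1$j + A$i$2 * B$2$j"
  by (simp add: matrix_matrix_mult_def sum_2)

lemma matrix_eq_2:
  fixes A B :: "complex^2^2"
  shows "A = B \<longleftrightarrow> A$1$1 = B$1$1 \<and> A$1$2 = B$1$2 \<and> A$2$1 = B$2$1 \<and> A$2$2 = B$2$2"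
  by (auto simp: vec_eq_iff forall_2)

definition mat2 :: "complex \<Rightarrow> complex \<Rightarrow> complex \<Rightarrow> complex \<Rightarrow> complex^2^2" where
  "mat2 a b c d = vector [vector [a, b], vector [c, d]]"

lemma mat2_nth [simp]:
  "mat2 a b c d $ 1 $ 1 = a" "mat2 a b c d $ 1 $ 2 = b"
  "mat2 a b c d $ 2 $ 1 = c" "mat2 a b c d $ 2 $ 2 = d"
  by (simp_all add: mat2_def vector_2)

lemma mat_nth [simp]:
  "(mat k :: complex^2^2) $ 1 $ 1 = k" "(mat k :: complex^2^2) $ 1 $ 2 = 0"
  "(mat k :: complex^2^2) $ 2 $ 1 = 0" "(mat k :: complex^2^2) $ 2 $ 2 = k"
  by (simp_all add: mat_def)

lemma det_mat2 [simp]: "det (mat2 a b c d) = a * d - b * c"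
  by (simp add: det_2)

text \<open>The denominator of the Moebius transformation \<open>z \<mapsto> (az + b) / (cz + d)\<close> of a matrix \<open>A\<close> is named
because it is the cocycle of the action (\<open>mob_den_mult\<close> below), and because the derivative of the
transformation is \<^term>\<open>det A / (mob_den A z)\<^sup>2\<close>.\<close>

definition mob_den :: "complex^2^2 \<Rightarrow> complex \<Rightarrow> complex" where
  "mob_den A z = A$2$1 * z + A$2$2"

definition mob :: "complex^2^2 \<Rightarrow> complex \<Rightarrow> complex" where
  "mob A z = (A$1$1 * z + A$1$2) / mob_den A z"

lemma mat_act_Some:
  "mat_act A (Some z) = (if mob_den A z = 0 then None else Some (mob A z))"
  by (simp add: mat_act_def mob_def mob_den_def)

lemma mat_act_None:
  "mat_act A None = (if A$2$1 = 0 then None else Some (A$1$1 / A$2$1))"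
  by (simp add: mat_act_def)

lemma mob_den_poly_nonzero:
  fixes A :: "complex^2^2"
  shows "det A \<noteq> 0 \<Longrightarrow> [:A$2$2, A$2$1:] \<noteq> 0"
  by (auto simp: det_2)

lemma eventually_mob_den_nonzero:
  assumes "det A \<noteq> 0"
  shows "eventually (\<lambda>z. mob_den A z \<noteq> 0) cofinite"
  using eventually_cofinite_poly_nonzero[OF mob_den_poly_nonzero[OF assms]]
  by (simp add: mob_den_def add.commute mult.commute)

lemma mob_den_mult:
  assumes "mob_den B z \<noteq> 0"
  shows "mob_den (A ** B) z = mob_den A (mob B z) * mob_den B z"
proof -
  have "mob B z * mob_den B z = B$1$1 * z + B$1$2"
    using assms by (simp add: mob_def)
  thus ?thesis
    by (simp add: mob_den_def[of A] distrib_right mult.assoc)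
       (simp add: mob_den_def matrix_mult_2 algebra_simps)
qed

lemma mob_mult:
  assumes "mob_den B z \<noteq> 0"
  shows "mob (A ** B) z = mob A (mob B z)"
proof -
  have *: "mob B z * mob_den B z = B$1$1 * z + B$1$2"
    using assms by (simp add: mob_def)
  have "(A ** B)$1$1 * z + (A ** B)$1$2 = (A$1$1 * mob B z + A$1$2) * mob_den B z"
    by (simp add: distrib_right mult.assoc *)
       (simp add: mob_den_def matrix_mult_2 algebra_simps)
  thus ?thesis
    using assms by (simp add: mob_def[of "A ** B"] mob_den_mult mob_def[of A])
qed

lemma mob_inj:
  assumes "det A \<noteq> 0" "mob_den A z \<noteq> 0" "mob_den A w \<noteq> 0" "mob A z = mob A w"
  shows "z = w"
proof -
  have "(A$1$1 * z + A$1$2) * mob_den A w = (A$1$1 * w + A$1$2) * mob_den A z"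
    using assms by (simp add: mob_def frac_eq_eq)
  hence "det A * (z - w) = 0"
    by (simp add: det_2 mob_den_def algebra_simps)
  thus ?thesis using assms by simp
qed

text \<open>An injective substitution takes a finite exceptional set back to a finite one.\<close>

lemma eventually_cofinite_mob:
  assumes "det A \<noteq> 0" "eventually P cofinite"
  shows "eventually (\<lambda>z. P (mob A z)) cofinite"
proof -
  have "inj_on (mob A) {z. mob_den A z \<noteq> 0}"
    using mob_inj[OF assms(1)] by (auto simp: inj_on_def)
  hence "finite (mob A -` {w. \<not> P w} \<inter> {z. mob_den A z \<noteq> 0})"
    using assms(2) by (intro finite_vimage_IntI) (auto simp: eventually_cofinite)
  moreover have "finite {z. mob_den A z = 0}"
    using eventually_mob_den_nonzero[OF assms(1)] by (simp add: eventually_cofinite)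
  ultimately have "finite ((mob A -` {w. \<not> P w} \<inter> {z. mob_den A z \<noteq> 0}) \<union> {z. mob_den A z = 0})"
    by blast
  thus ?thesis
    unfolding eventually_cofinite by (rule finite_subset[rotated]) auto
qed

text \<open>Matrices of any nonzero determinant are allowed, so that the chart \<open>1/z\<close> at infinity is covered as
well.\<close>

definition mob_pullback :: "complex^2^2 \<Rightarrow> ratform \<Rightarrow> ratform" where
  "mob_pullback A f = pullback (mat_ratfun A) f"

lemma ratfun_val_pull:
  assumes "det A \<noteq> 0"
  shows "eventually (\<lambda>z. ratfun_val (mob_pullback A f) z =
           ratfun_val f (mob A z) * (det A / (mob_den A z)\<^sup>2))
           cofinite"
proof -
  let ?t = "mat_ratfun A" and ?v = "[:A$2$2, A$2$1:]" and ?u = "[:A$1$2, A$1$1:]"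
  note v = mob_den_poly_nonzero[OF assms]
  have v2: "?v ^ 2 \<noteq> 0" using v by simp
  have d: "ratfun_deriv ?t = Fract (pderiv ?u * ?v - ?u * pderiv ?v) (?v ^ 2)"
    unfolding mat_ratfun_def by (rule ratfun_deriv_Fract[OF v])
  have num: "poly (pderiv ?u * ?v - ?u * pderiv ?v) z = det A" for z
    by (simp add: pderiv_pCons det_2 algebra_simps)
  have den: "poly ?v z = mob_den A z" for z
    by (simp add: mob_den_def algebra_simps)
  from ratfun_val_comp[of f ?t] ratfun_val_mult[of "ratfun_comp f ?t" "ratfun_deriv ?t"]
    ratfun_val_Fract[OF v, of ?u, folded mat_ratfun_def]
    ratfun_val_Fract[OF v2, of "pderiv ?u * ?v - ?u * pderiv ?v", folded d]
  show ?thesis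
  proof eventually_elim
    case (elim z)
    have "ratfun_val ?t z = mob A z"
      using elim(3) unfolding den by (simp add: mob_def algebra_simps)
    moreover have "ratfun_val (ratfun_deriv ?t) z = det A / (mob_den A z)\<^sup>2"
      using elim(4) unfolding num poly_power den .
    ultimately show ?case
      using elim(1,2) by (simp add: mob_pullback_def pullback_def)
  qed
qed

lemma ratfun_eqI_eventually:
  assumes "eventually (\<lambda>z. ratfun_val f z = ratfun_val g z) cofinite"
  shows "f = g"
  by (rule ratfun_eqI, rule eventually_frequently) (use assms in \<open>auto simp: infinite_UNIV_char_0\<close>)

lemma mob_pullback_one [simp]: "mob_pullback (mat 1) f = f"
proof (rule ratfun_eqI_eventually)
  have "det (mat 1 :: complex^2^2) \<noteq> 0" by simp
  from ratfun_val_pull[OF this, of f]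
  show "eventually (\<lambda>z. ratfun_val (mob_pullback (mat 1) f) z = ratfun_val f z) cofinite"
    by (simp add: mob_def mob_den_def)
qed

text \<open>Contravariant functoriality, that is, the chain rule. It is what turns the isotropy of a form into a
group and allows to move a fixed point to the origin.\<close>

lemma mob_pullback_mult:
  assumes "det A \<noteq> 0" "det B \<noteq> 0"
  shows "mob_pullback (A ** B) f = mob_pullback B (mob_pullback A f)"
proof (rule ratfun_eqI_eventually)
  have "det (A ** B) \<noteq> 0" using assms by (simp add: det_mul)
  from ratfun_val_pull[OF this, of f] eventually_mob_den_nonzero[OF assms(2)]
    ratfun_val_pull[OF assms(2), of "mob_pullback A f"]
    eventually_cofinite_mob[OF assms(2) ratfun_val_pull[OF assms(1), of f]]
  show "eventually (\<lambda>z. ratfun_val (mob_pullback (A ** B) f) z =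
      ratfun_val (mob_pullback B (mob_pullback A f)) z) cofinite"
    by eventually_elim (simp add: mob_mult mob_den_mult det_mul power_mult_distrib)
qed

lemma mat2_inverse:
  fixes A :: "complex^2^2"
  assumes "det A \<noteq> 0"
  obtains B where "det B \<noteq> 0" "A ** B = mat 1" "B ** A = mat 1"
proof -
  obtain B where B: "A ** B = mat 1" "B ** A = mat 1"
    using assms by (auto simp: invertible_det_nz[symmetric] invertible_def)
  have "det A * det B = 1" using B(1) by (metis det_I det_mul)
  hence "det B \<noteq> 0" by auto
  thus ?thesis using B that by blast
qed

lemma mob_pullback_0 [simp]: "mob_pullback A 0 = 0"
  by (simp add: mob_pullback_def pullback_def ratfun_comp_def)

lemma mob_pullback_eq_0_iff:
  assumes "det A \<noteq> 0"
  shows "mob_pullback A f = 0 \<longleftrightarrow> f = 0"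
proof
  assume "mob_pullback A f = 0"
  moreover obtain B where B: "det B \<noteq> 0" "A ** B = mat 1"
    using mat2_inverse[OF assms] by blast
  ultimately have "mob_pullback (A ** B) f = 0"
    using mob_pullback_mult[OF assms, of B f] by simp
  thus "f = 0" unfolding B(2) by simp
qed simp

lemma mob_pullback_const_mult:
  assumes "det A \<noteq> 0"
  shows "mob_pullback A (to_fract [:c:] * f) = to_fract [:c:] * mob_pullback A f"
proof (rule ratfun_eqI_eventually)
  from ratfun_val_pull[OF assms, of f] ratfun_val_pull[OF assms, of "to_fract [:c:] * f"]
    ratfun_val_const[of c] eventually_cofinite_mob[OF assms ratfun_val_const[of c]]
    ratfun_val_mult[of "to_fract [:c:]" "mob_pullback A f"]
    eventually_cofinite_mob[OF assms ratfun_val_mult[of "to_fract [:c:]" f]]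
  show "eventually (\<lambda>z. ratfun_val (mob_pullback A (to_fract [:c:] * f)) z =
      ratfun_val (to_fract [:c:] * mob_pullback A f) z) cofinite"
    by eventually_elim simp
qed

lemma mat_act_one [simp]: "mat_act (mat 1) x = x"
  by (cases x) (simp_all add: mat_act_def)

lemma mat_act_mult:
  assumes "det A \<noteq> 0" "det B \<noteq> 0"
  shows "mat_act (A ** B) x = mat_act A (mat_act B x)"
proof (cases x)
  case (Some z)
  show ?thesis
  proof (cases "mob_den B z = 0")
    case False
    thus ?thesis by (simp add: Some mat_act_Some mob_mult mob_den_mult)
  next
    case True
    let ?n = "B$1$1 * z + B$1$2"
    \<comment> \<open>\<open>B\<close> sends \<open>z\<close> to infinity; its numerator cannot vanish there as well.\<close>
    have "det B = B$1$1 * mob_den B z - B$2$1 * ?n"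
      by (simp add: det_2 mob_den_def algebra_simps)
    hence n: "?n \<noteq> 0" using True assms(2) by auto
    have "mob_den (A ** B) z = A$2$1 * ?n + A$2$2 * mob_den B z"
      by (simp add: mob_den_def matrix_mult_2 algebra_simps)
    hence den: "mob_den (A ** B) z = A$2$1 * ?n" using True by simp
    have "(A ** B)$1$1 * z + (A ** B)$1$2 = A$1$1 * ?n + A$1$2 * mob_den B z"
      by (simp add: mob_den_def matrix_mult_2 algebra_simps)
    hence num: "(A ** B)$1$1 * z + (A ** B)$1$2 = A$1$1 * ?n" using True by simp
    have "mob (A ** B) z = A$1$1 / A$2$1" if "A$2$1 \<noteq> 0"
      unfolding mob_def num den using n that by (metis mult_divide_mult_cancel_right)
    thus ?thesis
      using True n by (simp add: Some mat_act_Some mat_act_None den)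
  qed
next
  case None
  show ?thesis
  proof (cases "B$2$1 = 0")
    case True
    hence "B$1$1 \<noteq> 0" using assms(2) by (auto simp: det_2)
    thus ?thesis by (simp add: None mat_act_None True matrix_mult_2)
  next
    case False
    let ?w = "B$1$1 / B$2$1"
    have "(A ** B)$2$1 = mob_den A ?w * B$2$1" "(A ** B)$1$1 = (A$1$1 * ?w + A$1$2) * B$2$1"
      using False by (simp_all add: matrix_mult_2 mob_den_def distrib_right)
    thus ?thesis using False by (simp add: None mat_act_None mat_act_Some mob_def)
  qed
qed

section \<open>Orders as limits\<close>

lemma eventually_at_of_cofinite:
  fixes a :: complex
  assumes "eventually P cofinite"
  shows "eventually P (at a)"
proof -
  have "finite {z. \<not> P z}" using assms by (simp add: eventually_cofinite)
  hence "\<not> a islimpt {z. \<not> P z}" by (rule islimpt_finite)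
  thus ?thesis by (simp add: islimpt_iff_eventually)
qed

text \<open>The order at \<open>a\<close> is the unique exponent \<open>k\<close> for which the quotient by \<open>(z - a) ^ k\<close> has a nonzero
limit at \<open>a\<close>. In this form the order can be followed through a change of coordinate.\<close>

lemma ratfun_order_limit:
  assumes "f \<noteq> 0"
  obtains L where "L \<noteq> 0"
    "((\<lambda>z. ratfun_val f z / (z - a) powi ratfun_order a f) \<longlongrightarrow> L) (at a)"
proof -
  define p q where "p = fst (quot_of_fract f)" and "q = snd (quot_of_fract f)"
  define m n where "m = Polynomial.order a p" and "n = Polynomial.order a q"
  have "p \<noteq> 0" "q \<noteq> 0" using assms by (auto simp: p_def q_def)
  then obtain p1 q1 where p: "p = [:-a, 1:] ^ m * p1" "\<not> [:-a, 1:] dvd p1"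
    and q: "q = [:-a, 1:] ^ n * q1" "\<not> [:-a, 1:] dvd q1"
    unfolding m_def n_def using order_decomp by meson
  have nz: "poly p1 a \<noteq> 0" "poly q1 a \<noteq> 0"
    using p(2) q(2) by (auto simp: poly_eq_0_iff_dvd)
  have ord: "ratfun_order a f = int m - int n"
    by (simp add: ratfun_order_def case_prod_beta m_def n_def p_def q_def)
  have "((\<lambda>z. poly p1 z / poly q1 z) \<longlongrightarrow> poly p1 a / poly q1 a) (at a)"
    using nz by (intro tendsto_intros)
  moreover have "eventually (\<lambda>z. poly p1 z / poly q1 z =
      ratfun_val f z / (z - a) powi ratfun_order a f) (at a)"
    using eventually_neq_at_within[of a a UNIV]
  proof eventually_elim
    case (elim z)
    have "ratfun_val f z = ((z - a) ^ m * poly p1 z) / ((z - a) ^ n * poly q1 z)"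
      by (simp add: ratfun_val_def flip: p_def q_def) (simp add: p(1) q(1))
    moreover have "(z - a) powi (int m - int n) = (z - a) ^ m / (z - a) ^ n"
      using elim by (simp add: power_int_diff)
    ultimately show ?case
      unfolding ord using elim by (simp add: field_simps)
  qed
  ultimately have "((\<lambda>z. ratfun_val f z / (z - a) powi ratfun_order a f) \<longlongrightarrow> poly p1 a / poly q1 a) (at a)"
    by (rule Lim_transform_eventually)
  thus ?thesis using nz by (intro that[of "poly p1 a / poly q1 a"]) auto
qed

lemma limit_exponent_not_less:
  fixes F :: "complex \<Rightarrow> complex"
  assumes "((\<lambda>z. F z / (z - a) powi k) \<longlongrightarrow> L) (at a)" "L \<noteq> 0"
    and "((\<lambda>z. F z / (z - a) powi l) \<longlongrightarrow> M) (at a)"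
  shows "\<not> k < l"
proof
  assume "k < l"
  define n where "n = nat (l - k)"
  have n: "l = k + int n" "n > 0" using \<open>k < l\<close> by (auto simp: n_def)
  have "((\<lambda>z. F z / (z - a) powi l * (z - a) ^ n) \<longlongrightarrow> M * (a - a) ^ n) (at a)"
    by (intro tendsto_intros assms)
  moreover have "eventually (\<lambda>z. F z / (z - a) powi l * (z - a) ^ n = F z / (z - a) powi k) (at a)"
    using eventually_neq_at_within[of a a UNIV]
    by eventually_elim (simp add: n(1) power_int_add)
  ultimately have "((\<lambda>z. F z / (z - a) powi k) \<longlongrightarrow> 0) (at a)"
    using n(2) by (auto intro: Lim_transform_eventually simp: power_0_left)
  thus False using assms(1,2) tendsto_unique[OF at_neq_bot] by blast
qed

lemma ratfun_order_eqI:
  assumes "((\<lambda>z. ratfun_val f z / (z - a) powi k) \<longlongrightarrow> L) (at a)" "L \<noteq> 0"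
  shows "ratfun_order a f = k"
proof -
  have "f \<noteq> 0"
  proof
    assume "f = 0"
    hence "((\<lambda>z. 0) \<longlongrightarrow> L) (at a)" using assms(1) by (simp add: ratfun_val_def)
    thus False using assms(2) by (simp add: tendsto_const_iff)
  qed
  then obtain M where M: "M \<noteq> 0"
    "((\<lambda>z. ratfun_val f z / (z - a) powi ratfun_order a f) \<longlongrightarrow> M) (at a)"
    by (rule ratfun_order_limit)
  show ?thesis
    using limit_exponent_not_less[OF assms M(2)] limit_exponent_not_less[OF M(2,1) assms(1)]
    by linarith
qed

text \<open>Near \<open>0\<close> the map is \<open>z \<mapsto> a + l z + \<dots>\<close>, where \<open>a\<close> is the image of \<open>0\<close> and
\<open>l = det M / (mob_den M 0)\<^sup>2\<close> the derivative. So \<open>(w - a) ^ k\<close> contributes a factor \<open>l ^ k\<close> and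
\<open>dw\<close> another factor \<open>l\<close>. The order is thus preserved, and at a fixed point the leading
coefficient is multiplied by \<open>l ^ (k + 1)\<close>.\<close>

lemma ratfun_val_pull_limit:
  assumes "det M \<noteq> 0" "mob_den M 0 \<noteq> 0"
    and "((\<lambda>w. ratfun_val f w / (w - mob M 0) powi k) \<longlongrightarrow> L) (at (mob M 0))"
  shows "((\<lambda>z. ratfun_val (mob_pullback M f) z / (z - 0) powi k) \<longlongrightarrow>
           L * (det M / (mob_den M 0)\<^sup>2) powi (k + 1)) (at 0)"
proof -
  let ?a = "mob M 0" and ?D = "det M" and ?d = "mob_den M 0"
  have cden: "(mob_den M \<longlongrightarrow> ?d) (at 0)"
    unfolding mob_den_def by (intro tendsto_intros)
  have ev: "eventually (\<lambda>z. mob_den M z \<noteq> 0) (at 0)"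
    using assms(1) by (intro eventually_at_of_cofinite eventually_mob_den_nonzero)
  have diff: "mob M z - ?a = z * (?D / (?d * mob_den M z))" if "mob_den M z \<noteq> 0" for z
    using that assms(2) by (simp add: mob_def field_simps) (simp add: mob_den_def det_2 algebra_simps)
  have "filterlim (mob M) (at ?a) (at 0)"
  proof (rule filterlim_atI)
    show "(mob M \<longlongrightarrow> ?a) (at 0)"
      unfolding mob_def[of M, abs_def] using assms(2) by (intro tendsto_intros cden)
    show "eventually (\<lambda>z. mob M z \<noteq> ?a) (at 0)"
      using ev eventually_neq_at_within[of 0 0 UNIV]
    proof eventually_elim
      case (elim z)
      have "mob M z - ?a \<noteq> 0" using diff[OF elim(1)] elim assms by simp
      thus ?case by simp
    qed
  qed
  hence "((\<lambda>z. ratfun_val f (mob M z) / (mob M z - ?a) powi k) \<longlongrightarrow> L) (at 0)"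
    by (rule filterlim_compose[OF assms(3)])
  hence "((\<lambda>z. ratfun_val f (mob M z) / (mob M z - ?a) powi k *
      ((?D / (?d * mob_den M z)) powi k * (?D / (mob_den M z)\<^sup>2))) \<longlongrightarrow>
      L * ((?D / (?d * ?d)) powi k * (?D / ?d\<^sup>2))) (at 0)"
    using assms(1,2) by (intro tendsto_intros tendsto_power_int cden) auto
  moreover have "eventually (\<lambda>z. ratfun_val f (mob M z) / (mob M z - ?a) powi k *
      ((?D / (?d * mob_den M z)) powi k * (?D / (mob_den M z)\<^sup>2)) =
      ratfun_val (mob_pullback M f) z / (z - 0) powi k) (at 0)"
    using ev eventually_neq_at_within[of 0 0 UNIV] eventually_at_of_cofinite[OF ratfun_val_pull[OF assms(1), of f]]
  proof eventually_elim
    case (elim z)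
    have nz: "?D / (?d * mob_den M z) \<noteq> 0" using elim assms by simp
    show ?case
      unfolding diff[OF elim(1)] elim(3) power_int_mult_distrib
      using nz elim(2) by simp
  qed
  ultimately have "((\<lambda>z. ratfun_val (mob_pullback M f) z / (z - 0) powi k) \<longlongrightarrow>
      L * ((?D / (?d * ?d)) powi k * (?D / ?d\<^sup>2))) (at 0)"
    by (rule Lim_transform_eventually)
  thus ?thesis
    using assms by (simp add: power_int_add power2_eq_square)
qed

lemma ratfun_order_pull:
  assumes "det M \<noteq> 0" "mob_den M 0 \<noteq> 0" "f \<noteq> 0"
  shows "ratfun_order 0 (mob_pullback M f) = ratfun_order (mob M 0) f"
proof -
  obtain L where L: "L \<noteq> 0"
    "((\<lambda>z. ratfun_val f z / (z - mob M 0) powi ratfun_order (mob M 0) f) \<longlongrightarrow> L) (at (mob M 0))"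
    using assms(3) by (rule ratfun_order_limit)
  show ?thesis
    by (rule ratfun_order_eqI[OF ratfun_val_pull_limit[OF assms(1,2) L(2)]])
       (use assms L(1) in simp)
qed

text \<open>The matrix of the chart \<open>z \<mapsto> 1/z\<close> at infinity.\<close>

abbreviation flip_mat :: "complex^2^2" where
  "flip_mat \<equiv> mat2 0 1 1 0"

lemma form_order_None: "form_order f None = ratfun_order 0 (mob_pullback flip_mat f)"
  by (simp add: form_order_def mob_pullback_def mat_ratfun_def one_pCons)

lemma flip_mat_flip_mat: "flip_mat ** flip_mat = mat 1"
  by (simp add: matrix_eq_2 matrix_mult_2)

text \<open>Every Moebius transformation may serve as a chart around the image of \<open>0\<close>. This treats the point
at infinity like any other point.\<close>

lemma form_order_chart:
  assumes "det M \<noteq> 0" "f \<noteq> 0"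
  shows "form_order f (mat_act M (Some 0)) = ratfun_order 0 (mob_pullback M f)"
proof (cases "mob_den M 0 = 0")
  case False
  thus ?thesis using ratfun_order_pull[OF assms(1) False assms(2)]
    by (simp add: mat_act_Some form_order_def)
next
  case True
  \<comment> \<open>Here \<open>M\<close> sends \<open>0\<close> to infinity, so it factors through the chart \<open>1/z\<close>.\<close>
  let ?N = "flip_mat ** M"
  have dN: "det ?N \<noteq> 0" using assms(1) by (simp add: det_mul)
  have M: "M = flip_mat ** ?N" by (simp add: matrix_mul_assoc flip_mat_flip_mat)
  have "M$2$2 = 0" using True by (simp add: mob_den_def)
  hence N: "mob_den ?N 0 \<noteq> 0" "mob ?N 0 = 0"
    using assms(1) by (auto simp: mob_den_def mob_def matrix_mult_2 det_2)
  have "form_order f (mat_act M (Some 0)) = ratfun_order 0 (mob_pullback flip_mat f)"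
    using True by (simp add: mat_act_Some form_order_None)
  also have "\<dots> = ratfun_order 0 (mob_pullback ?N (mob_pullback flip_mat f))"
    using ratfun_order_pull[OF dN N(1), of "mob_pullback flip_mat f"] N(2) assms(2)
    by (simp add: mob_pullback_eq_0_iff)
  also have "\<dots> = ratfun_order 0 (mob_pullback M f)"
    using dN by (subst (2) M) (simp add: mob_pullback_mult)
  finally show ?thesis .
qed

lemma mat_act_transitive:
  obtains M where "det M = 1" "mat_act M (Some 0) = x"
proof (cases x)
  case None
  thus ?thesis by (intro that[of "mat2 0 (-1) 1 0"]) (simp_all add: mat_act_def)
next
  case (Some a)
  thus ?thesis by (intro that[of "mat2 1 a 0 1"]) (simp_all add: mat_act_def)
qed

lemma form_order_pull:
  assumes "det A \<noteq> 0" "f \<noteq> 0"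
  shows "form_order (mob_pullback A f) x = form_order f (mat_act A x)"
proof -
  obtain M where M: "det M = 1" "mat_act M (Some 0) = x" by (rule mat_act_transitive)
  hence "form_order (mob_pullback A f) x = ratfun_order 0 (mob_pullback M (mob_pullback A f))"
    using form_order_chart[of M "mob_pullback A f"] assms by (simp add: mob_pullback_eq_0_iff)
  also have "\<dots> = ratfun_order 0 (mob_pullback (A ** M) f)"
    using assms M by (simp add: mob_pullback_mult)
  also have "\<dots> = form_order f (mat_act (A ** M) (Some 0))"
    using form_order_chart[of "A ** M" f] assms M by (simp add: det_mul)
  also have "\<dots> = form_order f (mat_act A x)"
    using assms M by (simp add: mat_act_mult)
  finally show ?thesis .
qed

section \<open>Forms with the same zeros and poles\<close>

text \<open>Over the complex numbers a polynomial is the product of its linear factors, up to a constant.\<close>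

lemma poly_proportional_if_orders_eq:
  fixes p q :: "complex poly"
  assumes "p \<noteq> 0" "q \<noteq> 0" "\<And>a. Polynomial.order a p = Polynomial.order a q"
  obtains c where "p = Polynomial.smult c q"
proof -
  have "poly p z = 0 \<longleftrightarrow> poly q z = 0" for z
    using assms order_root by metis
  hence "(\<Prod>z|poly p z = 0. [:-z, 1:] ^ Polynomial.order z p) =
      (\<Prod>z|poly q z = 0. [:-z, 1:] ^ Polynomial.order z q)" (is "?P = ?Q")
    by (simp add: assms(3))
  moreover have "Polynomial.smult (lead_coeff p) ?P = p" "Polynomial.smult (lead_coeff q) ?Q = q"
    by (rule complex_poly_decompose)+
  ultimately have "p = Polynomial.smult (lead_coeff p) ?Q" "q = Polynomial.smult (lead_coeff q) ?Q"
    by simp_all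
  moreover have "Polynomial.smult (lead_coeff p / lead_coeff q) (Polynomial.smult (lead_coeff q) ?Q) = Polynomial.smult (lead_coeff p) ?Q"
    using assms(2) by simp
  ultimately have "p = Polynomial.smult (lead_coeff p / lead_coeff q) q"
    by metis
  thus ?thesis by (rule that)
qed

text \<open>The finite points suffice here, because a rational function without zeros and poles in the plane is
constant.\<close>

lemma ratfun_proportional_if_orders_eq:
  assumes "f \<noteq> 0" "g \<noteq> 0" "\<And>a. ratfun_order a f = ratfun_order a g"
  obtains c where "f = to_fract [:c:] * g"
proof -
  define p q where "p = fst (quot_of_fract f)" and "q = snd (quot_of_fract f)"
  define r s where "r = fst (quot_of_fract g)" and "s = snd (quot_of_fract g)"
  have nz: "p \<noteq> 0" "q \<noteq> 0" "r \<noteq> 0" "s \<noteq> 0"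
    using assms by (auto simp: p_def q_def r_def s_def)
  have f: "f = Fract p q" and g: "g = Fract r s" by (simp_all add: p_def q_def r_def s_def)
  have "Polynomial.order a (p * s) = Polynomial.order a (r * q)" for a
    using assms(3)[of a] nz
    by (simp add: ratfun_order_def case_prod_beta order_mult flip: p_def q_def r_def s_def)
  then obtain c where "p * s = Polynomial.smult c (r * q)"
    using nz by (auto intro: poly_proportional_if_orders_eq[of "p * s" "r * q"])
  hence "f = to_fract [:c:] * g"
    using nz by (simp add: f g to_fract_def eq_fract)
  thus ?thesis by (rule that)
qed

section \<open>Parabolic transformations\<close>

text \<open>The value is the same at infinitely many points \<open>n b\<close>, namely beyond the finitely many
where the periodicity fails.\<close>

lemma periodic_ratfun_const:
  assumes "b \<noteq> 0" "eventually (\<lambda>z. ratfun_val f (z + b) = ratfun_val f z) cofinite"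
  obtains c where "f = to_fract [:c:]"
proof -
  have inj: "inj (\<lambda>n::nat. of_nat n * b)"
    using assms(1) by (auto simp: inj_def)
  have "finite ((\<lambda>n::nat. of_nat n * b) -` {z. ratfun_val f (z + b) \<noteq> ratfun_val f z})"
    using assms(2) inj by (intro finite_vimageI) (simp_all add: eventually_cofinite)
  then obtain n0 where n0:
    "\<And>n. n \<in> (\<lambda>n. of_nat n * b) -` {z. ratfun_val f (z + b) \<noteq> ratfun_val f z} \<Longrightarrow> n < n0"
    by (metis finite_nat_set_iff_bounded)
  define c where "c = ratfun_val f (of_nat n0 * b)"
  have val: "ratfun_val f (of_nat n * b) = c" if "n \<ge> n0" for n
    using that
  proof (induction n rule: dec_induct)
    case (step n)
    have "ratfun_val f (of_nat n * b + b) = ratfun_val f (of_nat n * b)"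
      using n0[of n] step.hyps by auto
    thus ?case using step.IH by (simp add: algebra_simps)
  qed (simp add: c_def)
  have "infinite ((\<lambda>n::nat. of_nat n * b) ` {n0..})"
    using inj by (subst finite_image_iff) (auto intro: inj_on_subset simp: infinite_Ici)
  moreover have "(\<lambda>n::nat. of_nat n * b) ` {n0..} \<subseteq> {z. ratfun_val f z = c}"
    using val by auto
  ultimately have "frequently (\<lambda>z. ratfun_val f z = c) cofinite"
    unfolding frequently_cofinite using finite_subset by blast
  hence "frequently (\<lambda>z. ratfun_val f z = ratfun_val (to_fract [:c:]) z) cofinite"
  proof (rule frequently_rev_mp)
    show "eventually (\<lambda>z. ratfun_val f z = c \<longrightarrow> ratfun_val f z = ratfun_val (to_fract [:c:]) z) cofinite"
      using ratfun_val_const[of c] by eventually_elim simp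
  qed
  thus ?thesis by (intro that[of c] ratfun_eqI)
qed

lemma form_order_const_None:
  assumes "c \<noteq> 0"
  shows "form_order (to_fract [:c:]) None = -2"
  unfolding form_order_None
proof (rule ratfun_order_eqI)
  have d: "det flip_mat \<noteq> 0" by simp
  have "eventually (\<lambda>z. - c = ratfun_val (mob_pullback flip_mat (to_fract [:c:])) z / (z - 0) powi -2) (at 0)"
    using eventually_at_of_cofinite[OF ratfun_val_pull[OF d, of "to_fract [:c:]"]]
      eventually_at_of_cofinite[OF eventually_cofinite_mob[OF d ratfun_val_const[of c]]]
      eventually_neq_at_within[of 0 0 UNIV]
    by eventually_elim (simp add: mob_den_def power_int_minus)
  thus "((\<lambda>z. ratfun_val (mob_pullback flip_mat (to_fract [:c:])) z / (z - 0) powi -2) \<longlongrightarrow> - c) (at 0)"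
    by (rule tendsto_eventually[OF eventually_mono]) simp
qed (use assms in simp)

text \<open>A form that is invariant under a translation \<open>z \<mapsto> z + b\<close> is a constant multiple of \<open>dz\<close>, which has
a double pole at infinity. So no parabolic transformation preserves a form whose poles are
simple.\<close>

lemma translation_invariant_form_order_None:
  assumes "det C = 1" "C$2$1 = 0" "C$1$1 = C$2$2" "C$1$2 \<noteq> 0"
    and "mob_pullback C f = f" "f \<noteq> 0"
  shows "form_order f None = -2"
proof -
  have sq: "(C$2$2)\<^sup>2 = 1" using assms(1-3) by (simp add: det_2 power2_eq_square)
  hence nz: "C$2$2 \<noteq> 0" by auto
  have "det C \<noteq> 0" using assms(1) by simp
  from ratfun_val_pull[OF this, of f]
  have "eventually (\<lambda>z. ratfun_val f (z + C$1$2 / C$2$2) = ratfun_val f z) cofinite"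
  proof eventually_elim
    case (elim z)
    have "mob_den C z = C$2$2" "mob C z = z + C$1$2 / C$2$2"
      using nz assms(2,3) by (simp_all add: mob_def mob_den_def add_divide_distrib)
    thus ?case using elim by (simp add: sq assms(1,5))
  qed
  then obtain c where "f = to_fract [:c:]"
    using nz assms(4) by (auto intro: periodic_ratfun_const[of "C$1$2 / C$2$2" f])
  thus ?thesis using assms(6) by (auto simp: form_order_const_None)
qed

section \<open>Multipliers at fixed points\<close>

lemma mat_scalar_conj_iff:
  fixes A B M :: "complex^2^2"
  assumes "det M \<noteq> 0" "A ** M = M ** B"
  shows "A = mat k \<longleftrightarrow> B = mat k"
proof -
  obtain N where N: "M ** N = mat 1" "N ** M = mat 1"
    using mat2_inverse[OF assms(1)] by blast
  have comm: "mat k ** X = X ** mat k" for X :: "complex^2^2"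
    by (simp add: matrix_eq_2 matrix_mult_2)
  have B: "B = N ** (A ** M)"
    unfolding assms(2) by (simp add: matrix_mul_assoc N)
  have A: "A = (M ** B) ** N"
    unfolding assms(2)[symmetric] by (simp add: N flip: matrix_mul_assoc)
  show ?thesis
  proof
    assume "A = mat k"
    thus "B = mat k" by (simp add: B comm) (simp add: matrix_mul_assoc N)
  next
    assume "B = mat k"
    thus "A = mat k" by (simp add: A flip: comm) (simp add: N flip: matrix_mul_assoc)
  qed
qed

text \<open>Conjugating by \<open>M\<close> moves the fixed point \<open>x\<close> to the origin; a matrix \<open>B\<close> fixing the origin is lower
triangular.\<close>

lemma fixed_point_normal_form:
  assumes "det A = 1" "mat_act A x = x"
  obtains M B where "det M = 1" "det B = 1" "mat_act M (Some 0) = x" "A ** M = M ** B"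
    "B$1$2 = 0" "B$2$2 \<noteq> 0"
proof -
  obtain M where M: "det M = 1" "mat_act M (Some 0) = x" by (rule mat_act_transitive)
  have "det M \<noteq> 0" using M by simp
  then obtain N where N: "det N \<noteq> 0" "M ** N = mat 1" "N ** M = mat 1"
    by (rule mat2_inverse)
  define B where "B = N ** (A ** M)"
  have "det N * det M = 1" using N(3) by (metis det_I det_mul)
  hence "det B = 1" using M assms by (simp add: B_def det_mul)
  have "mat_act B (Some 0) = mat_act N (mat_act M (Some 0))"
    using N M assms by (simp add: B_def mat_act_mult det_mul)
  also have "\<dots> = Some 0"
    using mat_act_mult[of N M "Some 0"] N M by simp
  finally have "B$1$2 = 0" "B$2$2 \<noteq> 0"
    by (auto simp: mat_act_Some mob_def mob_den_def split: if_splits)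
  moreover have "A ** M = M ** B"
    by (simp add: B_def matrix_mul_assoc N)
  ultimately show ?thesis using M \<open>det B = 1\<close> that by blast
qed

text \<open>The heart of the argument. Here \<open>l\<close> is the derivative of the transformation at its fixed point
\<open>x\<close>; in the normal form \<open>B = (a 0; b d)\<close> with \<open>a d = 1\<close> it is \<open>l = a/d = 1/d\<^sup>2\<close>. The value of \<open>c\<close> comes
from comparing leading coefficients at \<open>x\<close>. If \<open>l = 1\<close> then the transformation is parabolic, as it is
not the identity, and a form that it preserves has a double pole at \<open>x\<close>. Finally \<open>l = -1\<close> means
\<open>a = -d\<close>, which characterises the involutions.\<close>

lemma fixed_point_multiplier:
  assumes "det A = 1" "mat_act A x = x" "A \<noteq> mat 1" "A \<noteq> mat (-1)"
    and "f \<noteq> 0" "mob_pullback A f = to_fract [:c:] * f"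
  obtains l where "c = l powi (form_order f x + 1)"
    "l = 1 \<longrightarrow> c = 1 \<longrightarrow> form_order f x = -2"
    "A ** A = mat 1 \<or> A ** A = mat (-1) \<longleftrightarrow> l = -1"
proof -
  obtain M B where M: "det M = 1" "mat_act M (Some 0) = x" and B: "det B = 1" "B$1$2 = 0" "B$2$2 \<noteq> 0"
    and AM: "A ** M = M ** B"
    using assms(1,2) by (rule fixed_point_normal_form)
  have d0: "det A \<noteq> 0" "det M \<noteq> 0" "det B \<noteq> 0" using assms(1) M B by simp_all
  have ad: "B$1$1 * B$2$2 = 1" using B by (simp add: det_2)
  have B_scalar: "A = mat k \<longleftrightarrow> B = mat k" for k
    by (rule mat_scalar_conj_iff[OF d0(2) AM])
  have "(A ** A) ** M = M ** (B ** B)"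
    using AM by (metis matrix_mul_assoc)
  hence B2_scalar: "A ** A = mat k \<longleftrightarrow> B ** B = mat k" for k
    by (rule mat_scalar_conj_iff[OF d0(2)])
  define h where "h = mob_pullback M f"
  define l where "l = det B / (mob_den B 0)\<^sup>2"
  define k where "k = form_order f x"
  have l: "l = 1 / (B$2$2)\<^sup>2" using B by (simp add: l_def mob_den_def)
  have h0: "h \<noteq> 0" using assms(5) d0 by (simp add: h_def mob_pullback_eq_0_iff)
  have k: "k = ratfun_order 0 h"
    using form_order_chart[of M f] d0 M assms(5) by (simp add: k_def h_def)
  have Bh: "mob_pullback B h = to_fract [:c:] * h"
    unfolding h_def mob_pullback_mult[OF d0(2,3), symmetric] AM[symmetric] mob_pullback_mult[OF d0(1,2)] assms(6)
    by (rule mob_pullback_const_mult[OF d0(2)])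
  obtain L where L: "L \<noteq> 0" "((\<lambda>z. ratfun_val h z / (z - 0) powi k) \<longlongrightarrow> L) (at 0)"
    unfolding k using h0 by (rule ratfun_order_limit)
  have "mob_den B 0 \<noteq> 0" "mob B 0 = 0" using B by (simp_all add: mob_def mob_den_def)
  hence "((\<lambda>z. ratfun_val (mob_pullback B h) z / (z - 0) powi k) \<longlongrightarrow> L * l powi (k + 1)) (at 0)"
    using ratfun_val_pull_limit[of B h k L] d0 L(2) by (simp add: l_def)
  moreover have "((\<lambda>z. ratfun_val (mob_pullback B h) z / (z - 0) powi k) \<longlongrightarrow> c * L) (at 0)"
  proof (rule Lim_transform_eventually)
    show "((\<lambda>z. c * (ratfun_val h z / (z - 0) powi k)) \<longlongrightarrow> c * L) (at 0)"
      by (intro tendsto_intros L)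
    show "eventually (\<lambda>z. c * (ratfun_val h z / (z - 0) powi k) =
        ratfun_val (mob_pullback B h) z / (z - 0) powi k) (at 0)"
      unfolding Bh
      using eventually_at_of_cofinite[OF ratfun_val_mult[of "to_fract [:c:]" h]]
        eventually_at_of_cofinite[OF ratfun_val_const[of c]]
      by eventually_elim simp
  qed
  ultimately have "L * l powi (k + 1) = c * L"
    by (rule tendsto_unique[OF at_neq_bot])
  hence c: "c = l powi (form_order f x + 1)" using L(1) by (simp add: k_def)
  moreover have "form_order f x = -2" if "l = 1" "c = 1"
  proof -
    have sq: "(B$2$2)\<^sup>2 = 1" using that(1) B(3) by (simp add: l)
    have "B$1$1 * B$2$2 = B$2$2 * B$2$2" using ad sq by (simp add: power2_eq_square)
    hence eq: "B$1$1 = B$2$2" using B(3) by simp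
    have "B$2$1 \<noteq> 0"
    proof
      assume "B$2$1 = 0"
      hence "B = mat (B$2$2)" using B(2) eq by (simp add: matrix_eq_2)
      moreover have "B$2$2 = 1 \<or> B$2$2 = -1" using sq by (simp add: power2_eq_1_iff)
      ultimately show False using B_scalar assms(3,4) by metis
    qed
    \<comment> \<open>\<open>B\<close> is parabolic with fixed point \<open>0\<close>. In the coordinate \<open>1/z\<close> it becomes a translation.\<close>
    define C where "C = flip_mat ** B ** flip_mat"
    have C: "C$2$1 = 0" "C$1$1 = C$2$2" "C$1$2 \<noteq> 0" "det C = 1"
      using B eq \<open>B$2$1 \<noteq> 0\<close> by (simp_all add: C_def matrix_mult_2 det_mul)
    have f0: "det flip_mat \<noteq> 0" by simp
    have dC: "det C \<noteq> 0" using C by simp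
    have FC: "flip_mat ** C = B ** flip_mat"
      by (simp add: C_def matrix_mul_assoc flip_mat_flip_mat)
    have "mob_pullback C (mob_pullback flip_mat h) = mob_pullback flip_mat (mob_pullback B h)"
      unfolding mob_pullback_mult[OF f0 dC, symmetric] mob_pullback_mult[OF d0(3) f0, symmetric] FC ..
    also have "mob_pullback B h = h" using Bh that(2) by (simp add: to_fract_1 flip: one_pCons)
    finally have inv: "mob_pullback C (mob_pullback flip_mat h) = mob_pullback flip_mat h" .
    have "form_order (mob_pullback flip_mat h) None = -2"
      using translation_invariant_form_order_None[OF C(4,1-3) inv] h0 f0 by (simp add: mob_pullback_eq_0_iff)
    moreover have "mat_act flip_mat None = Some 0" by (simp add: mat_act_None)
    ultimately show ?thesis
      using form_order_pull[OF f0 h0, of None] form_order_pull[OF d0(2) assms(5), of "Some 0"] M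
      by (simp add: h_def)
  qed
  moreover have "A ** A = mat 1 \<or> A ** A = mat (-1) \<longleftrightarrow> l = -1"
  proof
    assume "l = -1"
    hence "- (B$2$2)\<^sup>2 = 1" using B(3) by (simp add: l field_simps)
    hence sq: "(B$2$2)\<^sup>2 = -1" by (metis minus_minus)
    hence "B$1$1 * B$2$2 = - B$2$2 * B$2$2" using ad by (simp add: power2_eq_square)
    hence "B$1$1 = - B$2$2" unfolding mult_cancel_right using B(3) by blast
    with sq have "B ** B = mat (-1)"
      using B(2) by (simp add: matrix_eq_2 matrix_mult_2 power2_eq_square)
    thus "A ** A = mat 1 \<or> A ** A = mat (-1)" by (simp add: B2_scalar)
  next
    assume "A ** A = mat 1 \<or> A ** A = mat (-1)"
    then obtain e where e: "B ** B = mat e" "e = 1 \<or> e = -1" using B2_scalar by blast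
    hence ent: "B$1$1 * B$1$1 = e" "B$2$1 * (B$1$1 + B$2$2) = 0" "B$2$2 * B$2$2 = e"
      using B(2) by (simp_all add: matrix_eq_2 matrix_mult_2 algebra_simps)
    have "B$1$1 \<noteq> B$2$2"
    proof
      assume eq: "B$1$1 = B$2$2"
      hence "B$2$1 = 0" using ent(2) B(3) by simp
      hence "B = mat (B$2$2)" using B(2) eq by (simp add: matrix_eq_2)
      moreover have "B$2$2 = 1 \<or> B$2$2 = -1" using ad eq by (simp add: square_eq_1_iff)
      ultimately show False using B_scalar assms(3,4) by metis
    qed
    moreover have "(B$1$1 - B$2$2) * (B$1$1 + B$2$2) = 0"
      using ent by (simp add: algebra_simps)
    ultimately have "B$1$1 = - B$2$2" by (simp add: add_eq_0_iff2)
    hence "(B$2$2)\<^sup>2 = -1" using ad by (simp add: power2_eq_square minus_equation_iff)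
    thus "l = -1" by (simp add: l)
  qed
  ultimately show ?thesis using that by blast
qed

text \<open>The finite fixed points are the roots of \<open>c z\<^sup>2 + (d - a) z - b\<close>; this polynomial is not constant if
infinity is not fixed.\<close>

lemma mat_act_fixed_point:
  assumes "det A = 1"
  obtains x where "mat_act A x = x"
proof (cases "A$2$1 = 0")
  case True
  thus ?thesis by (intro that[of None]) (simp add: mat_act_None)
next
  case False
  let ?p = "[:- A$1$2, A$2$2 - A$1$1, A$2$1:]"
  have "\<not> constant (poly ?p)" using False by (simp add: constant_degree)
  then obtain z where "poly ?p z = 0" using fundamental_theorem_of_algebra by blast
  hence z: "z * mob_den A z = A$1$1 * z + A$1$2"
    by (simp add: mob_den_def algebra_simps)
  have "det A = A$1$1 * mob_den A z - A$2$1 * (A$1$1 * z + A$1$2)"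
    by (simp add: mob_den_def det_2 algebra_simps)
  hence "mob_den A z \<noteq> 0" using assms by (auto simp flip: z)
  moreover from this have "mob A z = z" by (simp add: mob_def flip: z)
  ultimately show ?thesis by (intro that[of "Some z"]) (simp add: mat_act_Some)
qed

section \<open>Invariance under one transformation\<close>

lemma mat_act_image_eq_iff:
  assumes "det A \<noteq> 0"
  shows "mat_act A ` S = S \<longleftrightarrow> (\<forall>x. mat_act A x \<in> S \<longleftrightarrow> x \<in> S)"
proof -
  obtain B where B: "det B \<noteq> 0" "A ** B = mat 1" "B ** A = mat 1"
    using assms by (rule mat2_inverse)
  have AB: "mat_act A (mat_act B x) = x" "mat_act B (mat_act A x) = x" for x
    using mat_act_mult[of A B x] mat_act_mult[of B A x] B assms by simp_all
  have inj: "inj (mat_act A)" using AB(2) by (metis injI)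
  show ?thesis
  proof
    assume "mat_act A ` S = S"
    thus "\<forall>x. mat_act A x \<in> S \<longleftrightarrow> x \<in> S" using inj_image_mem_iff[OF inj, of _ S] by simp
  next
    assume *: "\<forall>x. mat_act A x \<in> S \<longleftrightarrow> x \<in> S"
    show "mat_act A ` S = S"
    proof
      show "mat_act A ` S \<subseteq> S" using * by auto
      show "S \<subseteq> mat_act A ` S"
      proof
        fix y assume "y \<in> S"
        hence "mat_act B y \<in> S" using * AB(1) by metis
        thus "y \<in> mat_act A ` S" using AB(1) by (metis imageI)
      qed
    qed
  qed
qed

text \<open>With simple zeros and poles only, the sets of zeros and poles determine the order function, whose
values are \<open>-1\<close>, \<open>0\<close> and \<open>1\<close>.\<close>

lemma form_order_eq_iff:
  assumes "simple_poles_and_zeros f"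
  shows "form_order f x = form_order f y \<longleftrightarrow>
    (x \<in> form_poles f \<longleftrightarrow> y \<in> form_poles f) \<and> (x \<in> form_zeros f \<longleftrightarrow> y \<in> form_zeros f)"
  using assms unfolding simple_poles_and_zeros_def form_poles_def form_zeros_def
  by (smt (verit) mem_Collect_eq)

text \<open>The theorem for a single transformation. If the form is preserved, then so are its orders, and
\<open>l ^ (k + 1) = 1\<close> at each fixed point, \<open>k\<close> being the order and \<open>l \<noteq> 1\<close> by simplicity. This
excludes \<open>k = 0\<close> and allows \<open>k = 1\<close> only for \<open>l = -1\<close>, which means that the transformation is an
involution. Conversely, if the sets of zeros and poles are preserved, then the pull-back is a constant
multiple \<open>c f\<close>, and a single fixed point with \<open>k = -1\<close>, or with \<open>k = 1\<close> and \<open>l = -1\<close>, forces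
\<open>c = l ^ (k + 1) = 1\<close>.\<close>

lemma mob_pullback_eq_self_iff:
  assumes "det A = 1" "A \<noteq> mat 1" "A \<noteq> mat (-1)" "f \<noteq> 0" "simple_poles_and_zeros f"
  shows "mob_pullback A f = f \<longleftrightarrow>
    mat_act A ` form_poles f = form_poles f \<and> mat_act A ` form_zeros f = form_zeros f \<and>
    (\<forall>x. mat_act A x = x \<longrightarrow> x \<in> form_poles f \<or>
       x \<in> form_zeros f \<and> (A ** A = mat 1 \<or> A ** A = mat (-1)))"
    (is "_ \<longleftrightarrow> ?P \<and> ?Z \<and> ?F")
proof -
  have d: "det A \<noteq> 0" using assms(1) by simp
  have orders: "?P \<and> ?Z \<longleftrightarrow> (\<forall>x. form_order f (mat_act A x) = form_order f x)"
    unfolding mat_act_image_eq_iff[OF d] form_order_eq_iff[OF assms(5)] by blast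
  have trichotomy: "x \<in> form_poles f \<and> form_order f x = -1 \<or> x \<in> form_zeros f \<and> form_order f x = 1
      \<or> form_order f x = 0" for x
    using assms(5) unfolding simple_poles_and_zeros_def form_poles_def form_zeros_def
    by (smt (verit) mem_Collect_eq)
  show ?thesis
  proof
    assume inv: "mob_pullback A f = f"
    hence "?P \<and> ?Z"
      using form_order_pull[OF d assms(4)] by (simp add: orders)
    moreover have ?F
    proof (intro allI impI)
      fix x assume x: "mat_act A x = x"
      have "mob_pullback A f = to_fract [:1:] * f" using inv by (simp flip: one_pCons)
      then obtain l :: complex where l: "1 = l powi (form_order f x + 1)"
        "l = 1 \<longrightarrow> (1::complex) = 1 \<longrightarrow> form_order f x = -2"
        "A ** A = mat 1 \<or> A ** A = mat (-1) \<longleftrightarrow> l = -1"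
        by (rule fixed_point_multiplier[OF assms(1) x assms(2-4)])
      have "l \<noteq> 1" using l(2) trichotomy[of x] by auto
      thus "x \<in> form_poles f \<or> x \<in> form_zeros f \<and> (A ** A = mat 1 \<or> A ** A = mat (-1))"
        using trichotomy[of x] l(1) by (auto simp: l(3) power2_eq_1_iff eq_commute[of 1])
    qed
    ultimately show "?P \<and> ?Z \<and> ?F" by blast
  next
    assume *: "?P \<and> ?Z \<and> ?F"
    hence "form_order (mob_pullback A f) x = form_order f x" for x
      using orders form_order_pull[OF d assms(4)] by simp
    hence "ratfun_order a (mob_pullback A f) = ratfun_order a f" for a
      by (metis form_order_def option.case(2))
    then obtain c where c: "mob_pullback A f = to_fract [:c:] * f"
      using assms(4) d by (auto simp: mob_pullback_eq_0_iff intro: ratfun_proportional_if_orders_eq[of "mob_pullback A f" f])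
    obtain x where x: "mat_act A x = x" using assms(1) by (rule mat_act_fixed_point)
    obtain l where l: "c = l powi (form_order f x + 1)"
      "A ** A = mat 1 \<or> A ** A = mat (-1) \<longleftrightarrow> l = -1"
      by (rule fixed_point_multiplier[OF assms(1) x assms(2-4) c])
    have "x \<in> form_poles f \<or> x \<in> form_zeros f \<and> l = -1" using * x l(2) by blast
    hence "form_order f x = -1 \<or> form_order f x = 1 \<and> l = -1"
      using assms(5) by (auto simp: simple_poles_and_zeros_def)
    hence "c = 1" by (auto simp: l(1))
    thus "mob_pullback A f = f" using c by (simp flip: one_pCons)
  qed
qed

section \<open>Passage to PSL(2,C)\<close>

lemma mat_minus_one: "- mat 1 = (mat (-1) :: complex^2^2)"
  by (simp add: matrix_eq_2)

lemma PSL2C_one: "\<one>\<^bsub>PSL2C\<^esub> = {mat 1, - mat 1}"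
  by (simp add: PSL2C_def FactGroup_def)

lemma PSL2C_mult: "{A, - A} \<otimes>\<^bsub>PSL2C\<^esub> {B, - B} = {A ** B, - (A ** B)}"
  by (auto simp: PSL2C_def FactGroup_def set_mult_def SL2C_def matrix_mult_uminus)

lemma PSL2C_eq_one_iff: "{A, - A} = \<one>\<^bsub>PSL2C\<^esub> \<longleftrightarrow> A = mat 1 \<or> A = mat (-1)"
proof -
  have "- (mat (- 1)) = (mat 1 :: complex^2^2)" by (simp flip: mat_minus_one)
  moreover have "- A = mat 1 \<longleftrightarrow> A = - mat 1" by (metis minus_minus)
  ultimately show ?thesis
    unfolding PSL2C_one by (auto simp: doubleton_eq_iff simp flip: mat_minus_one)
qed

lemma PSL2C_cases:
  assumes "T \<in> carrier PSL2C"
  obtains A where "T = {A, - A}" "det A = 1"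
  using assms by (auto simp: carrier_PSL2C)

text \<open>Push-forward is pull-back along the inverse, and a form is fixed by a transformation if and only if
it is fixed by the inverse.\<close>

lemma pushforward_eq_self_iff:
  assumes "det A = 1"
  shows "pushforward {A, - A} f = f \<longleftrightarrow> mob_pullback A f = f"
proof -
  interpret group PSL2C by (rule group_PSL2C)
  obtain B where B: "A ** B = mat 1" "B ** A = mat 1"
    using mat2_inverse[of A] assms by auto
  have dB: "det B = 1" using arg_cong[OF B(1), of det] assms by (simp add: det_mul)
  have "inv\<^bsub>PSL2C\<^esub> {A, - A} = {B, - B}"
    using assms dB by (intro inv_equality) (auto simp: PSL2C_mult B PSL2C_one carrier_PSL2C)
  hence push: "pushforward {A, - A} f = mob_pullback B f"
    using dB by (simp add: pushforward_def PSL_ratfun_eq mob_pullback_def)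
  have "mob_pullback B (mob_pullback A f) = f" "mob_pullback A (mob_pullback B f) = f"
    using mob_pullback_mult[of A B f] mob_pullback_mult[of B A f] assms dB B by simp_all
  thus ?thesis unfolding push by metis
qed

lemma PSL2C_ord_gt_two_iff:
  assumes "g \<in> carrier PSL2C" "g \<noteq> \<one>\<^bsub>PSL2C\<^esub>"
  shows "group.ord PSL2C g = 0 \<or> group.ord PSL2C g > 2 \<longleftrightarrow> g [^]\<^bsub>PSL2C\<^esub> (2::nat) \<noteq> \<one>\<^bsub>PSL2C\<^esub>"
proof -
  interpret group PSL2C by (rule group_PSL2C)
  have "ord g \<noteq> 1" using assms ord_eq_1 by blast
  moreover have "g [^]\<^bsub>PSL2C\<^esub> (2::nat) = \<one>\<^bsub>PSL2C\<^esub> \<longleftrightarrow> ord g dvd 2"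
    using assms by (simp add: pow_eq_id)
  moreover have "ord g dvd 2 \<longleftrightarrow> ord g = 1 \<or> ord g = 2"
    using two_is_prime_nat unfolding prime_nat_iff by auto
  ultimately show ?thesis by linarith
qed

lemma pushforward_eq_self_iff_conditions:
  assumes "g \<in> carrier PSL2C" "f \<noteq> 0" "simple_poles_and_zeros f"
  shows "pushforward g f = f \<longleftrightarrow>
    PSL_act g ` form_poles f = form_poles f \<and> PSL_act g ` form_zeros f = form_zeros f \<and>
    (g \<noteq> \<one>\<^bsub>PSL2C\<^esub> \<longrightarrow>
      (g [^]\<^bsub>PSL2C\<^esub> (2::nat) = \<one>\<^bsub>PSL2C\<^esub> \<and> fixed_points g \<subseteq> form_poles f \<union> form_zeros f) \<or>
      ((group.ord PSL2C g = 0 \<or> group.ord PSL2C g > 2) \<and> fixed_points g \<subseteq> form_poles f))"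
proof -
  interpret group PSL2C by (rule group_PSL2C)
  obtain A where A: "g = {A, - A}" "det A = 1" using assms(1) by (rule PSL2C_cases)
  have act: "PSL_act g = mat_act A" by (simp add: fun_eq_iff A PSL_act_eq)
  show ?thesis
  proof (cases "g = \<one>\<^bsub>PSL2C\<^esub>")
    case True
    have "pushforward g f = f"
      using pushforward_eq_self_iff[of "mat 1" f] by (simp add: True PSL2C_one)
    moreover have "PSL_act g = id"
      by (simp add: True PSL2C_one fun_eq_iff PSL_act_eq)
    ultimately show ?thesis using True by simp
  next
    case False
    hence nt: "A \<noteq> mat 1" "A \<noteq> mat (-1)" by (auto simp: A PSL2C_eq_one_iff)
    have sq: "g [^]\<^bsub>PSL2C\<^esub> (2::nat) = \<one>\<^bsub>PSL2C\<^esub> \<longleftrightarrow> A ** A = mat 1 \<or> A ** A = mat (-1)"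
      using assms(1) by (simp add: numeral_2_eq_2 A PSL2C_mult PSL2C_eq_one_iff)
    have "pushforward g f = f \<longleftrightarrow> mob_pullback A f = f"
      unfolding A(1) by (rule pushforward_eq_self_iff[OF A(2)])
    thus ?thesis
      using False unfolding PSL2C_ord_gt_two_iff[OF assms(1) False] act fixed_points_def sq
        mob_pullback_eq_self_iff[OF A(2) nt assms(2,3)]
      by blast
  qed
qed

text \<open>Both sides are conditions on the single elements of \<open>H\<close>. Infinite \<open>H\<close> have to be covered for the
maximality statement: the isotropy group of \<open>dz/z\<close> contains all \<open>z \<mapsto> l z\<close>.\<close>

lemma form_invariant_iff_conditions:
  assumes "H \<subseteq> carrier PSL2C" "f \<noteq> 0" "simple_poles_and_zeros f"
  shows "form_invariant H f \<longleftrightarrow> invariance_conditions H f"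
proof -
  have "form_invariant H f \<longleftrightarrow> (\<forall>g\<in>H.
    PSL_act g ` form_poles f = form_poles f \<and> PSL_act g ` form_zeros f = form_zeros f \<and>
    (g \<noteq> \<one>\<^bsub>PSL2C\<^esub> \<longrightarrow>
      (g [^]\<^bsub>PSL2C\<^esub> (2::nat) = \<one>\<^bsub>PSL2C\<^esub> \<and> fixed_points g \<subseteq> form_poles f \<union> form_zeros f) \<or>
      ((group.ord PSL2C g = 0 \<or> group.ord PSL2C g > 2) \<and> fixed_points g \<subseteq> form_poles f)))"
    unfolding form_invariant_def
    using assms(1)
    by (intro ball_cong[OF refl] pushforward_eq_self_iff_conditions[OF _ assms(2,3)]) blast
  thus ?thesis
    unfolding invariance_conditions_def set_invariant_def fixed_point_condition_def
    by (simp only: ball_conj_distrib)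
qed

lemma subgroup_isotropy_group: "subgroup (isotropy_group f) PSL2C"
proof -
  interpret group PSL2C by (rule group_PSL2C)
  have mem: "{A, - A} \<in> isotropy_group f \<longleftrightarrow> mob_pullback A f = f" if "det A = 1" for A
    using that by (auto simp: isotropy_group_def carrier_PSL2C pushforward_eq_self_iff)
  have sub: "isotropy_group f \<subseteq> carrier PSL2C" by (auto simp: isotropy_group_def)
  show ?thesis
  proof (rule subgroupI[OF sub])
    have "{mat 1, - mat 1} \<in> isotropy_group f" using mem[of "mat 1"] by simp
    thus "isotropy_group f \<noteq> {}" by blast
  next
    fix S T assume ST: "S \<in> isotropy_group f" "T \<in> isotropy_group f"
    obtain A where A: "S = {A, - A}" "det A = 1" using ST(1) sub by (blast elim: PSL2C_cases)
    obtain B where B: "T = {B, - B}" "det B = 1" using ST(2) sub by (blast elim: PSL2C_cases)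
    have "mob_pullback A f = f" "mob_pullback B f = f" using ST mem A B by simp_all
    hence "mob_pullback (A ** B) f = f" using A B by (simp add: mob_pullback_mult)
    thus "S \<otimes>\<^bsub>PSL2C\<^esub> T \<in> isotropy_group f"
      using mem[of "A ** B"] A B by (simp add: PSL2C_mult det_mul)
  next
    fix S assume S: "S \<in> isotropy_group f"
    have S': "S \<in> carrier PSL2C" using S sub by blast
    obtain A where A: "S = {A, - A}" "det A = 1" using S' by (rule PSL2C_cases)
    obtain B where B: "inv\<^bsub>PSL2C\<^esub> S = {B, - B}" "det B = 1"
      using inv_closed[OF S'] by (rule PSL2C_cases)
    have "{A ** B, - (A ** B)} = {mat 1, - mat 1}"
      using r_inv[OF S'] unfolding B(1) unfolding A(1) PSL2C_mult PSL2C_one .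
    hence "pushforward {A ** B, - (A ** B)} f = pushforward {mat 1, - mat 1} f" by simp
    hence "mob_pullback (A ** B) f = f"
      using pushforward_eq_self_iff[of "A ** B" f] pushforward_eq_self_iff[of "mat 1" f] A B
      by (simp add: det_mul)
    moreover have "mob_pullback A f = f" using S mem A by simp
    ultimately have "mob_pullback B f = f" using A B by (simp add: mob_pullback_mult)
    thus "inv\<^bsub>PSL2C\<^esub> S \<in> isotropy_group f" using mem B by simp
  qed
qed

text \<open>By the previous lemma a subgroup satisfies the three conditions if and only if it is contained in
the isotropy group. As the isotropy group is itself a subgroup, it is the largest one that satisfies
them.\<close>

theorem theorem3p5:
  fixes G :: "(complex^2^2) set set" and \<eta> :: ratform
  assumes "subgroup G PSL2C" and "finite G"
    and "\<eta> \<noteq> 0" and "simple_poles_and_zeros \<eta>"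
  shows "(form_invariant G \<eta> \<longleftrightarrow>
            set_invariant G (form_poles \<eta>) \<and>
            set_invariant G (form_zeros \<eta>) \<and>
            fixed_point_condition G \<eta>) \<and>
         ((invariance_conditions G \<eta> \<and>
           (\<forall>H. subgroup H PSL2C \<and> invariance_conditions H \<eta> \<longrightarrow> H \<subseteq> G)) \<longleftrightarrow>
            isotropy_group \<eta> = G)"
proof -
  have conditions_iff: "invariance_conditions H \<eta> \<longleftrightarrow> H \<subseteq> isotropy_group \<eta>"
    if "subgroup H PSL2C" for H
  proof -
    have H: "H \<subseteq> carrier PSL2C" using that by (rule subgroup.subset)
    show ?thesis
      using H form_invariant_iff_conditions[OF H assms(3,4)]
      by (auto simp: form_invariant_def isotropy_group_def)
  qed
  have "form_invariant G \<eta> \<longleftrightarrow> invariance_conditions G \<eta>"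
    using subgroup.subset[OF assms(1)] assms(3,4) by (rule form_invariant_iff_conditions)
  moreover have "(invariance_conditions G \<eta> \<and>
      (\<forall>H. subgroup H PSL2C \<and> invariance_conditions H \<eta> \<longrightarrow> H \<subseteq> G)) \<longleftrightarrow> isotropy_group \<eta> = G"
    using conditions_iff subgroup_isotropy_group[of \<eta>] assms(1) by (metis subset_antisym subset_refl)
  ultimately show ?thesis by (simp add: invariance_conditions_def)
qed

end
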